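(* Let $j\geq 2$ be an integer and let $n,m\geq j$ be integers. Let $\tau\in C^{1,1}([0,1]^2)$ satisfy $\tau\geq 0$, $\tau'_x\geq 0$ and $\tau'_y\geq 0$ on $[0,1]^2$, and let $$f(x,y)=\int_0^x\int_0^y t^{j-1}s^{j-1}\tau(t,s)\,ds\,dt,\quad (x,y)\in[0,1]^2.$$ Then $$f(x,y)\leq B_{n,m,j}f(x,y)\leq B_{n,m}f(x,y)\quad\text{for all }(x,y)\in[0,1]^2.$$
   Context: $\tau'_x$ and $\tau'_y$ denote the partial derivatives with respect to the first and the second variable, respectively. $C^{p,q}([0,1]^2)$ denotes the space of all real-valued functions on $[0,1]^2$ having continuous partial derivatives of order $p$ in the first variable, respectively $q$ in the second variable, i.e. all partial derivatives $\partial^{k+l}f/\partial x^k\partial y^l$ with $0\le k\le p$, $0\le l\le q$ exist and are continuous on $[0,1]^2$. With $p_{n,i}(x)=\binom{n}{i}x^i(1-x)^{n-i}$, the bivariate Bernstein operator $B_{n,m}$ and the bivariate Aldaz-Kounchev-Render operator $B_{n,m,j}$ are defined for $f\in C([0,1]^2)$ by $$B_{n,m}f(x,y)=\sum_{i=0}^{n}\sum_{k=0}^{m}f\left(\frac{i}{n},\frac{k}{m}\right)p_{n,i}(x)p_{m,k}(y),\qquad B_{n,m,j}f(x,y)=\sum_{i=0}^{n}\sum_{k=0}^{m}f\left(t_{n,i}^j,t_{m,k}^j\right)p_{n,i}(x)p_{m,k}(y),$$ where $$t_{n,k}^j=\left(\frac{k(k-1)\cdots(k-j+1)}{n(n-1)\cdots(n-j+1)}\right)^{1/j}$$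 (the superscript $j$ in $t_{n,k}^j$ is an index, not a power). *)

theory Defs
  imports "HOL-Analysis.Analysis"
begin

text \<open>
  Partial derivatives of a function on the closed unit square. Differentiation is relative
  to \<open>{0..1}\<close>, hence one-sided on the boundary; at points of the square the results depend
  only on the values of the function on the square.
\<close>

definition partial_x :: "(real \<Rightarrow> real \<Rightarrow> real) \<Rightarrow> real \<Rightarrow> real \<Rightarrow> real" where
  "partial_x f = (\<lambda>x y. vector_derivative (\<lambda>t. f t y) (at x within {0..1}))"

definition partial_y :: "(real \<Rightarrow> real \<Rightarrow> real) \<Rightarrow> real \<Rightarrow> real \<Rightarrow> real" where
  "partial_y f = (\<lambda>x y. vector_derivative (\<lambda>s. f x s) (at y within {0..1}))"

text \<open>
  \<open>C_pq p q f\<close> is the membership of \<open>f\<close> in \<open>C\<^sup>p\<^sup>,\<^sup>q([0,1]\<^sup>2)\<close>. The mixed derivative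
  of order \<open>(k, l)\<close> is taken as written, first \<open>l\<close> times in \<open>y\<close> and then \<open>k\<close> times in \<open>x\<close>.
  As \<open>vector_derivative\<close> is total, existence of each derivative is demanded separately.
\<close>

definition C_pq :: "nat \<Rightarrow> nat \<Rightarrow> (real \<Rightarrow> real \<Rightarrow> real) \<Rightarrow> bool" where
  "C_pq p q f \<longleftrightarrow>
     (\<forall>l<q. \<forall>x\<in>{0..1}. \<forall>y\<in>{0..1}.
        (\<lambda>s. (partial_y ^^ l) f x s) differentiable (at y within {0..1})) \<and>
     (\<forall>k<p. \<forall>l\<le>q. \<forall>x\<in>{0..1}. \<forall>y\<in>{0..1}.
        (\<lambda>t. (partial_x ^^ k) ((partial_y ^^ l) f) t y) differentiable (at x within {0..1})) \<and>
     (\<forall>k\<le>p. \<forall>l\<le>q. continuous_on ({0..1} \<times> {0..1})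
        (\<lambda>(x, y). (partial_x ^^ k) ((partial_y ^^ l) f) x y))"

text \<open>The basis polynomials \<open>p\<^sub>n\<^sub>,\<^sub>i(x)\<close> are the library's \<open>Bernstein n i x\<close>.\<close>

definition bernstein2 ::
  "nat \<Rightarrow> nat \<Rightarrow> (real \<Rightarrow> real \<Rightarrow> real) \<Rightarrow> real \<Rightarrow> real \<Rightarrow> real" where
  "bernstein2 n m f x y =
     (\<Sum>i=0..n. \<Sum>k=0..m. f (real i / real n) (real k / real m) * Bernstein n i x * Bernstein m k y)"

definition akr_node :: "nat \<Rightarrow> nat \<Rightarrow> nat \<Rightarrow> real" where
  "akr_node j n k = root j ((\<Prod>i<j. real k - real i) / (\<Prod>i<j. real n - real i))"

definition akr2 ::
  "nat \<Rightarrow> nat \<Rightarrow> nat \<Rightarrow> (real \<Rightarrow> real \<Rightarrow> real) \<Rightarrow> real \<Rightarrow> real \<Rightarrow> real" where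
  "akr2 n m j f x y =
     (\<Sum>i=0..n. \<Sum>k=0..m. f (akr_node j n i) (akr_node j m k) * Bernstein n i x * Bernstein m k y)"

end

theory Submission
  imports Defs
begin

text \<open>
  The nodes of the Aldaz--Kounchev--Render operator are chosen so that, with
  \<open>t\<^sub>k = akr_node j n k\<close>, the weights \<open>Bernstein n k x\<close> have total mass \<open>1\<close> and
  satisfy \<open>\<Sum>k. t\<^sub>k ^ j * Bernstein n k x = x ^ j\<close>: the operator fixes \<open>1\<close> and \<open>x ^ j\<close>
  (\<open>akr_moment\<close>). By Jensen's inequality it therefore lies above every function that is convex
  as a function of \<open>x ^ j\<close>. A function \<open>\<lambda>x. \<integral>\<^sub>0\<^sup>x t ^ (j - 1) * \<sigma> t dt\<close> with increasing
  \<open>\<sigma>\<close> is of that kind, because its derivative with respect to \<open>x ^ j\<close> is \<open>\<sigma> / j\<close>; the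
  supporting line at \<open>x\<close> is the content of \<open>weighted_primitive_supporting_line\<close>, and summing
  it against the weights gives \<open>weighted_primitive_le_akr\<close>.

  With the second variable frozen at \<open>b\<close>, the function \<open>f\<close> is of this form with
  \<open>\<sigma> t = \<integral>\<^sub>0\<^sup>b s ^ (j - 1) * \<tau> t s ds\<close>, which increases because \<open>\<tau>\<close> increases in its
  first variable; exchanging the integrals gives the same in the other variable. The bivariate
  operator is the composition of the two univariate ones, so applying the univariate inequality
  in each variable in turn gives the lower bound.

  The upper bound compares the two operators term by term: \<open>t\<^sub>k \<le> k / n\<close>
  (\<open>akr_node_le\<close>), and \<open>f\<close> increases in each variable since \<open>\<tau> \<ge> 0\<close>.
\<close>

section \<open>Nodes and moments\<close>

lemma falling_prod_eq_binomial:
  "(\<Prod>i<j. real k - real i) = fact j * real (k choose j)"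
  using gbinomial_mult_fact [of j "real k"]
  by (simp add: binomial_gbinomial atLeast0LessThan)

lemma akr_node_eq_binomial:
  "akr_node j n k = root j (real (k choose j) / real (n choose j))"
  by (simp add: akr_node_def falling_prod_eq_binomial)

lemma akr_node_nonneg: "0 < j \<Longrightarrow> 0 \<le> akr_node j n k"
  by (simp add: akr_node_eq_binomial)

lemma akr_node_power:
  "0 < j \<Longrightarrow> akr_node j n k ^ j = real (k choose j) / real (n choose j)"
  by (simp add: akr_node_eq_binomial)

text \<open>
  The \<open>j\<close>-th power of a node is a product of factors \<open>(k - i) / (n - i)\<close>, none of which exceeds
  \<open>k / n\<close> as long as all are nonnegative. For \<open>k < j\<close> negative factors may occur, but then the
  factor with \<open>i = k\<close> vanishes.
\<close>

lemma akr_node_le: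
  assumes "0 < j" "j \<le> n" "k \<le> n"
  shows "akr_node j n k \<le> real k / real n"
proof -
  have "(\<Prod>i<j. real k - real i) / (\<Prod>i<j. real n - real i) \<le> (real k / real n) ^ j"
  proof (cases "k < j")
    case True
    then have zero: "(\<Prod>i<j. real k - real i) = 0"
      by (simp add: falling_prod_eq_binomial)
    show ?thesis unfolding zero by simp
  next
    case False
    have "(\<Prod>i<j. real k - real i) / (\<Prod>i<j. real n - real i)
        = (\<Prod>i<j. (real k - real i) / (real n - real i))"
      by (simp add: prod_dividef)
    also have "\<dots> \<le> (\<Prod>i<j. real k / real n)"
    proof (intro prod_mono conjI)
      fix i assume i: "i \<in> {..<j}"
      then show "0 \<le> (real k - real i) / (real n - real i)"
        using False assms by auto
      have "real i * real k \<le> real i * real n"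
        using assms by (intro mult_left_mono) auto
      then show "(real k - real i) / (real n - real i) \<le> real k / real n"
        using i assms by (simp add: field_simps)
    qed
    finally show ?thesis by simp
  qed
  then have "akr_node j n k \<le> root j ((real k / real n) ^ j)"
    unfolding akr_node_def using assms(1) by simp
  also have "\<dots> = real k / real n"
    using assms(1) by (simp add: real_root_power_cancel)
  finally show ?thesis .
qed

lemma akr_node_mem:
  assumes "0 < j" "j \<le> n" "k \<le> n"
  shows "akr_node j n k \<in> {0..1}"
proof -
  have "real k / real n \<le> 1" using assms by (simp add: divide_le_eq)
  with akr_node_le [OF assms] akr_node_nonneg [OF assms(1), of n k] show ?thesis by auto
qed

text \<open>
  Choosing \<open>k\<close> out of \<open>n\<close> and then \<open>j\<close> out of these \<open>k\<close> is the same as choosing the \<open>j\<close>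
  elements first. The moment thus reduces to the total mass of the Bernstein weights of degree
  \<open>n - j\<close>.
\<close>

lemma binomial_moment_Bernstein:
  assumes "j \<le> n"
  shows "(\<Sum>k=0..n. real (k choose j) * Bernstein n k x) = real (n choose j) * x ^ j"
proof -
  have "(\<Sum>k=0..n. real (k choose j) * Bernstein n k x)
      = (\<Sum>k=j..n. real (k choose j) * Bernstein n k x)"
    by (rule sum.mono_neutral_right) auto
  also have "\<dots> = (\<Sum>k=0..n - j. real (k + j choose j) * Bernstein n (k + j) x)"
    using sum.shift_bounds_cl_nat_ivl [of "\<lambda>k. real (k choose j) * Bernstein n k x" 0 j "n - j"] assms
    by simp
  also have "\<dots> = (\<Sum>k=0..n - j. real (n choose j) * x ^ j * Bernstein (n - j) k x)"
  proof (rule sum.cong [OF refl])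
    fix k assume "k \<in> {0..n - j}"
    then have "(n choose (k + j)) * (k + j choose j) = (n choose j) * ((n - j) choose k)"
      using choose_mult [of j "k + j" n] assms by simp
    then have "real (n choose (k + j)) * real (k + j choose j)
        = real (n choose j) * real ((n - j) choose k)"
      by (metis of_nat_mult)
    moreover have "n - (k + j) = n - j - k" by simp
    ultimately show "real (k + j choose j) * Bernstein n (k + j) x
        = real (n choose j) * x ^ j * Bernstein (n - j) k x"
      unfolding Bernstein_def by (simp add: power_add mult_ac)
  qed
  also have "\<dots> = real (n choose j) * x ^ j"
    by (simp flip: sum_distrib_left add: atLeast0AtMost)
  finally show ?thesis .
qed

lemma akr_moment:
  assumes "0 < j" "j \<le> n"
  shows "(\<Sum>k=0..n. akr_node j n k ^ j * Bernstein n k x) = x ^ j"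
proof -
  have "(\<Sum>k=0..n. akr_node j n k ^ j * Bernstein n k x)
      = (\<Sum>k=0..n. real (k choose j) * Bernstein n k x) / real (n choose j)"
    by (simp add: akr_node_power [OF assms(1)] sum_divide_distrib)
  then show ?thesis
    using assms by (simp add: binomial_moment_Bernstein)
qed

section \<open>The univariate inequality\<close>

lemma integral_power_pred:
  fixes a :: real
  assumes "0 < j" "0 \<le> a"
  shows "((\<lambda>t. t ^ (j - 1)) has_integral a ^ j / real j) {0..a}"
proof -
  have "((\<lambda>t. t ^ (j - 1)) has_integral a ^ j / real j - 0 ^ j / real j) {0..a}"
    using assms
    by (intro fundamental_theorem_of_calculus)
       (auto intro!: derivative_eq_intros simp flip: has_real_derivative_iff_has_vector_derivative)
  moreover have "(0 :: real) ^ j = 0" using assms by simp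
  ultimately show ?thesis by (simp only: div_0 diff_zero)
qed

text \<open>
  As a function of \<open>x ^ j\<close>, the primitive has slope \<open>\<sigma> x / j\<close> at \<open>x\<close>. After subtraction of
  the line with this slope, the integrand is \<open>t ^ (j - 1) * (\<sigma> t - \<sigma> x)\<close>, which is \<open>\<le> 0\<close>
  to the left of \<open>x\<close> and \<open>\<ge> 0\<close> to its right, so the difference has its minimum at \<open>x\<close>.
\<close>

lemma weighted_primitive_supporting_line:
  fixes \<sigma> :: "real \<Rightarrow> real" and j :: nat
  defines "\<phi> \<equiv> \<lambda>x. integral {0..x} (\<lambda>t. t ^ (j - 1) * \<sigma> t)"
  assumes j: "0 < j"
    and cont: "continuous_on {0..1} \<sigma>" and mono: "mono_on {0..1} \<sigma>"
    and x: "x \<in> {0..1}" and a: "a \<in> {0..1}"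
  shows "\<phi> x + \<sigma> x / real j * (a ^ j - x ^ j) \<le> \<phi> a"
proof -
  define h where "h t = t ^ (j - 1) * (\<sigma> t - \<sigma> x)" for t
  have int_h: "h integrable_on {u..v}" if "0 \<le> u" "v \<le> 1" for u v
    unfolding h_def using that
    by (intro integrable_continuous_real continuous_intros continuous_on_subset [OF cont]) auto
  have primitive_h: "integral {0..b} h = \<phi> b - \<sigma> x / real j * b ^ j" if b: "b \<in> {0..1}" for b
  proof -
    have "(\<lambda>t. t ^ (j - 1) * \<sigma> t) integrable_on {0..b}"
      using b by (intro integrable_continuous_real continuous_intros continuous_on_subset [OF cont]) auto
    then have "((\<lambda>t. t ^ (j - 1) * \<sigma> t) has_integral \<phi> b) {0..b}"
      unfolding \<phi>_def by (rule integrable_integral)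
    moreover have "((\<lambda>t. \<sigma> x * t ^ (j - 1)) has_integral \<sigma> x * (b ^ j / real j)) {0..b}"
      using integral_power_pred [OF j] b by (intro has_integral_mult_right) auto
    ultimately have "((\<lambda>t. t ^ (j - 1) * \<sigma> t - \<sigma> x * t ^ (j - 1))
        has_integral \<phi> b - \<sigma> x * (b ^ j / real j)) {0..b}"
      by (rule has_integral_diff)
    then have "(h has_integral \<phi> b - \<sigma> x * (b ^ j / real j)) {0..b}"
      by (rule has_integral_eq [rotated]) (simp add: h_def algebra_simps)
    then show ?thesis by (simp add: integral_unique)
  qed
  have "integral {0..x} h \<le> integral {0..a} h"
  proof (cases "x \<le> a")
    case True
    have "0 \<le> integral {x..a} h"
    proof (rule integral_nonneg [OF int_h])
      fix t assume "t \<in> {x..a}"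
      then show "0 \<le> h t"
        unfolding h_def using x a
        by (intro mult_nonneg_nonneg zero_le_power) (auto intro: mono_onD [OF mono])
    qed (use x a in auto)
    then show ?thesis
      using Henstock_Kurzweil_Integration.integral_combine [of 0 x a h] int_h x a True by auto
  next
    case False
    have "integral {a..x} h \<le> integral {a..x} (\<lambda>t. 0)"
    proof (rule integral_le [OF int_h])
      fix t assume "t \<in> {a..x}"
      then show "h t \<le> 0"
        unfolding h_def using x a
        by (intro mult_nonneg_nonpos zero_le_power) (auto intro: mono_onD [OF mono])
    qed (use x a in auto)
    then show ?thesis
      using Henstock_Kurzweil_Integration.integral_combine [of 0 a x h] int_h x a False by auto
  qed
  then have "\<phi> x - \<sigma> x / real j * x ^ j \<le> \<phi> a - \<sigma> x / real j * a ^ j"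
    by (simp only: primitive_h x a)
  then show ?thesis
    by (simp only: right_diff_distrib)
qed

lemma weighted_primitive_le_akr:
  fixes \<sigma> :: "real \<Rightarrow> real" and j :: nat
  defines "\<phi> \<equiv> \<lambda>x. integral {0..x} (\<lambda>t. t ^ (j - 1) * \<sigma> t)"
  assumes j: "0 < j" "j \<le> n"
    and cont: "continuous_on {0..1} \<sigma>" and mono: "mono_on {0..1} \<sigma>"
    and x: "x \<in> {0..1}"
  shows "\<phi> x \<le> (\<Sum>k=0..n. \<phi> (akr_node j n k) * Bernstein n k x)"
proof -
  define c where "c = \<sigma> x / real j"
  have mass: "(\<Sum>k=0..n. Bernstein n k x) = 1"
    by (simp add: atLeast0AtMost)
  have "\<phi> x = (\<phi> x - c * x ^ j) * (\<Sum>k=0..n. Bernstein n k x)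
      + c * (\<Sum>k=0..n. akr_node j n k ^ j * Bernstein n k x)"
    by (simp add: mass akr_moment j)
  also have "\<dots> = (\<Sum>k=0..n. (\<phi> x + c * (akr_node j n k ^ j - x ^ j)) * Bernstein n k x)"
    by (simp add: sum_distrib_left flip: sum.distrib) (simp add: algebra_simps)
  also have "\<dots> \<le> (\<Sum>k=0..n. \<phi> (akr_node j n k) * Bernstein n k x)"
  proof (intro sum_mono mult_right_mono)
    fix k assume "k \<in> {0..n}"
    then have "akr_node j n k \<in> {0..1}"
      using j by (intro akr_node_mem) auto
    then show "\<phi> x + c * (akr_node j n k ^ j - x ^ j) \<le> \<phi> (akr_node j n k)"
      unfolding \<phi>_def c_def
      by (rule weighted_primitive_supporting_line [OF j(1) cont mono x])
    show "0 \<le> Bernstein n k x"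
      using x by (simp add: Bernstein_nonneg)
  qed
  finally show ?thesis .
qed

section \<open>Functions on the square\<close>

lemma mono_on_vector_derivative_nonneg:
  fixes g :: "real \<Rightarrow> real"
  assumes diff: "\<And>x. x \<in> {0..1} \<Longrightarrow> g differentiable (at x within {0..1})"
    and nonneg: "\<And>x. x \<in> {0..1} \<Longrightarrow> 0 \<le> vector_derivative g (at x within {0..1})"
  shows "mono_on {0..1} g"
proof (rule mono_onI)
  fix a b :: real assume ab: "a \<in> {0..1}" "b \<in> {0..1}" "a \<le> b"
  show "g a \<le> g b"
  proof (rule DERIV_nonneg_imp_increasing_open [OF ab(3)])
    fix x assume x: "a < x" "x < b"
    then have x01: "x \<in> {0..1}" and "x \<in> interior {0..1}"
      using ab by auto
    then have "at x within {0..1} = at x"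
      by (intro at_within_interior)
    then show "\<exists>y. (g has_real_derivative y) (at x) \<and> 0 \<le> y"
      using diff [OF x01] nonneg [OF x01]
      by (auto simp: vector_derivative_works has_real_derivative_iff_has_vector_derivative)
  next
    have "continuous_on {0..1} g"
      using diff by (auto simp: continuous_on_eq_continuous_within intro: differentiable_imp_continuous_within)
    then show "continuous_on {a..b} g"
      by (rule continuous_on_subset) (use ab in auto)
  qed
qed

lemma continuous_on_section_integral:
  fixes \<tau> :: "real \<Rightarrow> real \<Rightarrow> real"
  assumes cont: "continuous_on ({0..1} \<times> {0..1}) (\<lambda>(t, s). \<tau> t s)" and b: "b \<le> 1"
  shows "continuous_on {0..1} (\<lambda>t. integral {0..b} (\<lambda>s. s ^ (j - 1) * \<tau> t s))"
proof -
  have "continuous_on ({0..1} \<times> cbox 0 b) (\<lambda>(t, s). s ^ (j - 1) * \<tau> t s)"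
    unfolding split_beta using cont b
    by (intro continuous_intros) (auto simp: split_beta intro: continuous_on_subset)
  from integral_continuous_on_param [OF this] show ?thesis by simp
qed

lemma continuous_on_section:
  fixes \<tau> :: "real \<Rightarrow> real \<Rightarrow> real"
  assumes cont: "continuous_on ({0..1} \<times> {0..1}) (\<lambda>(t, s). \<tau> t s)"
    and t: "t \<in> {0..1}" and b: "b \<le> 1"
  shows "continuous_on {0..b} (\<tau> t)"
proof -
  have pair: "continuous_on {0..b} (\<lambda>s. (t, s))"
    by (intro continuous_intros)
  have range: "(\<lambda>s. (t, s)) ` {0..b} \<subseteq> {0..1} \<times> {0..1}"
    using t b by auto
  from continuous_on_compose2 [OF cont pair range] show ?thesis by simp
qed

lemma section_integral_mono:
  fixes \<tau> :: "real \<Rightarrow> real \<Rightarrow> real"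
  assumes cont: "continuous_on ({0..1} \<times> {0..1}) (\<lambda>(t, s). \<tau> t s)" and b: "b \<le> 1"
    and mono: "\<And>s. s \<in> {0..1} \<Longrightarrow> mono_on {0..1} (\<lambda>t. \<tau> t s)"
  shows "mono_on {0..1} (\<lambda>t. integral {0..b} (\<lambda>s. s ^ (j - 1) * \<tau> t s))"
proof (rule mono_onI)
  fix t u :: real assume tu: "t \<in> {0..1}" "u \<in> {0..1}" "t \<le> u"
  have int: "(\<lambda>s. s ^ (j - 1) * \<tau> v s) integrable_on {0..b}" if "v \<in> {0..1}" for v
    by (intro integrable_continuous_real continuous_intros continuous_on_section [OF cont that b])
  show "integral {0..b} (\<lambda>s. s ^ (j - 1) * \<tau> t s) \<le> integral {0..b} (\<lambda>s. s ^ (j - 1) * \<tau> u s)"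
    using tu b by (intro integral_le int) (auto intro!: mult_left_mono mono_onD [OF mono])
qed

lemma section_integral_nonneg:
  fixes \<tau> :: "real \<Rightarrow> real \<Rightarrow> real"
  assumes cont: "continuous_on ({0..1} \<times> {0..1}) (\<lambda>(t, s). \<tau> t s)" and b: "b \<le> 1"
    and nonneg: "\<And>t s. t \<in> {0..1} \<Longrightarrow> s \<in> {0..1} \<Longrightarrow> 0 \<le> \<tau> t s"
    and t: "t \<in> {0..1}"
  shows "0 \<le> integral {0..b} (\<lambda>s. s ^ (j - 1) * \<tau> t s)"
  using b t nonneg
  by (intro integral_nonneg integrable_continuous_real continuous_intros
      continuous_on_section [OF cont t b]) auto

definition weighted_double_primitive ::
  "nat \<Rightarrow> (real \<Rightarrow> real \<Rightarrow> real) \<Rightarrow> real \<Rightarrow> real \<Rightarrow> real" where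
  "weighted_double_primitive j \<tau> a b =
     integral {0..a} (\<lambda>t. t ^ (j - 1) * integral {0..b} (\<lambda>s. s ^ (j - 1) * \<tau> t s))"

text \<open>
  Exchanging the integrals amounts to transposing \<open>\<tau>\<close>, so everything shown for the first
  variable carries over to the second.
\<close>

lemma weighted_double_primitive_swap:
  assumes cont: "continuous_on ({0..1} \<times> {0..1}) (\<lambda>(t, s). \<tau> t s)"
    and ab: "a \<in> {0..1}" "b \<in> {0..1}"
  shows "weighted_double_primitive j \<tau> a b = weighted_double_primitive j (\<lambda>s t. \<tau> t s) b a"
proof -
  have "continuous_on (cbox (0, 0) (a, b)) (\<lambda>(t, s). t ^ (j - 1) * (s ^ (j - 1) * \<tau> t s))"
    unfolding split_beta using cont ab
    by (intro continuous_intros)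
       (auto simp: split_beta cbox_Pair_eq intro: continuous_on_subset)
  from integral_swap_continuous [OF this]
  have "weighted_double_primitive j \<tau> a b
      = integral {0..b} (\<lambda>s. integral {0..a} (\<lambda>t. s ^ (j - 1) * (t ^ (j - 1) * \<tau> t s)))"
    by (simp add: weighted_double_primitive_def mult.left_commute)
  then show ?thesis
    by (simp add: weighted_double_primitive_def)
qed

lemma weighted_double_primitive_le_akr:
  assumes cont: "continuous_on ({0..1} \<times> {0..1}) (\<lambda>(t, s). \<tau> t s)"
    and mono: "\<And>s. s \<in> {0..1} \<Longrightarrow> mono_on {0..1} (\<lambda>t. \<tau> t s)"
    and j: "0 < j" "j \<le> n"
    and x: "x \<in> {0..1}" and b: "b \<in> {0..1}"
  shows "weighted_double_primitive j \<tau> x b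
    \<le> (\<Sum>k=0..n. weighted_double_primitive j \<tau> (akr_node j n k) b * Bernstein n k x)"
  unfolding weighted_double_primitive_def using b
  by (intro weighted_primitive_le_akr [OF j _ _ x] continuous_on_section_integral [OF cont]
      section_integral_mono [OF cont _ mono]) auto

lemma weighted_double_primitive_mono:
  assumes cont: "continuous_on ({0..1} \<times> {0..1}) (\<lambda>(t, s). \<tau> t s)"
    and nonneg: "\<And>t s. t \<in> {0..1} \<Longrightarrow> s \<in> {0..1} \<Longrightarrow> 0 \<le> \<tau> t s"
    and a: "0 \<le> a" "a \<le> a'" "a' \<le> 1" and b: "b \<in> {0..1}"
  shows "weighted_double_primitive j \<tau> a b \<le> weighted_double_primitive j \<tau> a' b"
proof -
  let ?\<sigma> = "\<lambda>t. integral {0..b} (\<lambda>s. s ^ (j - 1) * \<tau> t s)"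
  have b1: "b \<le> 1" using b by simp
  have int: "(\<lambda>t. t ^ (j - 1) * ?\<sigma> t) integrable_on {0..c}" if "c \<le> 1" for c
    using that
    by (intro integrable_continuous_real continuous_intros
        continuous_on_subset [OF continuous_on_section_integral [OF cont b1]]) auto
  have nonneg_integrand: "0 \<le> t ^ (j - 1) * ?\<sigma> t" if t: "t \<in> {0..a'}" for t
  proof (rule mult_nonneg_nonneg)
    show "0 \<le> t ^ (j - 1)" using t by simp
    have "t \<in> {0..1}" using t a by simp
    then show "0 \<le> ?\<sigma> t" by (intro section_integral_nonneg [OF cont b1]) (auto intro: nonneg)
  qed
  show ?thesis
    unfolding weighted_double_primitive_def
  proof (rule integral_subset_le)
    show "{0..a} \<subseteq> {0..a'}" using a by simp
    show "(\<lambda>t. t ^ (j - 1) * ?\<sigma> t) integrable_on {0..a}" by (rule int) (use a in simp)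
    show "(\<lambda>t. t ^ (j - 1) * ?\<sigma> t) integrable_on {0..a'}" by (rule int) (use a in simp)
    show "\<forall>t\<in>{0..a'}. 0 \<le> t ^ (j - 1) * ?\<sigma> t" using nonneg_integrand by blast
  qed
qed

section \<open>The bivariate operators\<close>

theorem mainTheorem8:
  fixes j n m :: nat and \<tau> f :: "real \<Rightarrow> real \<Rightarrow> real"
  assumes "2 \<le> j" and "j \<le> n" and "j \<le> m"
    and "C_pq 1 1 \<tau>"
    and "\<And>x y. \<lbrakk>x \<in> {0..1}; y \<in> {0..1}\<rbrakk> \<Longrightarrow> 0 \<le> \<tau> x y"
    and "\<And>x y. \<lbrakk>x \<in> {0..1}; y \<in> {0..1}\<rbrakk> \<Longrightarrow> 0 \<le> partial_x \<tau> x y"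
    and "\<And>x y. \<lbrakk>x \<in> {0..1}; y \<in> {0..1}\<rbrakk> \<Longrightarrow> 0 \<le> partial_y \<tau> x y"
    and "\<And>x y. \<lbrakk>x \<in> {0..1}; y \<in> {0..1}\<rbrakk> \<Longrightarrow>
           f x y = integral {0..x} (\<lambda>t. integral {0..y} (\<lambda>s. t ^ (j - 1) * s ^ (j - 1) * \<tau> t s))"
  shows "\<forall>x\<in>{0..1}. \<forall>y\<in>{0..1}.
           f x y \<le> akr2 n m j f x y \<and> akr2 n m j f x y \<le> bernstein2 n m f x y"
proof (intro ballI conjI)
  fix x y :: real assume x: "x \<in> {0..1}" and y: "y \<in> {0..1}"
  have j: "0 < j" using assms(1) by simp
  let ?\<tau>' = "\<lambda>s t. \<tau> t s"
  have cont: "continuous_on ({0..1} \<times> {0..1}) (\<lambda>(t, s). \<tau> t s)"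
  proof -
    have "\<forall>k\<le>1. \<forall>l\<le>1. continuous_on ({0..1} \<times> {0..1})
        (\<lambda>(x, y). (partial_x ^^ k) ((partial_y ^^ l) \<tau>) x y)"
      using assms(4) unfolding C_pq_def by blast
    from this [rule_format, of 0 0] show ?thesis by simp
  qed
  have swap: "continuous_on ({0..1} \<times> {0..1}) (\<lambda>p :: real \<times> real. (snd p, fst p))"
    by (intro continuous_intros)
  have range: "(\<lambda>p. (snd p, fst p)) ` ({0..1} \<times> {0..1}) \<subseteq> {0..1::real} \<times> {0..1::real}"
    by auto
  from continuous_on_compose2 [OF cont swap range]
  have cont': "continuous_on ({0..1} \<times> {0..1}) (\<lambda>(s, t). \<tau> t s)"
    by (simp add: split_beta)
  have mono_x: "mono_on {0..1} (\<lambda>t. \<tau> t s)" if s: "s \<in> {0..1}" for s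
  proof (rule mono_on_vector_derivative_nonneg)
    have "\<forall>k<1. \<forall>l\<le>1. \<forall>x\<in>{0..1}. \<forall>y\<in>{0..1}.
        (\<lambda>t. (partial_x ^^ k) ((partial_y ^^ l) \<tau>) t y) differentiable (at x within {0..1})"
      using assms(4) unfolding C_pq_def by blast
    from this [rule_format, of 0 0]
    show "(\<lambda>t. \<tau> t s) differentiable (at t within {0..1})" if "t \<in> {0..1}" for t
      using that s by simp
    show "0 \<le> vector_derivative (\<lambda>t. \<tau> t s) (at t within {0..1})" if "t \<in> {0..1}" for t
      using assms(6) [OF that s] by (simp add: partial_x_def)
  qed
  have mono_y: "mono_on {0..1} (\<lambda>s. \<tau> t s)" if t: "t \<in> {0..1}" for t
  proof (rule mono_on_vector_derivative_nonneg)
    have "\<forall>l<1. \<forall>x\<in>{0..1}. \<forall>y\<in>{0..1}.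
        (\<lambda>s. (partial_y ^^ l) \<tau> x s) differentiable (at y within {0..1})"
      using assms(4) unfolding C_pq_def by (rule conjunct1)
    from this [rule_format, of 0]
    show "(\<lambda>s. \<tau> t s) differentiable (at s within {0..1})" if "s \<in> {0..1}" for s
      using that t by simp
    show "0 \<le> vector_derivative (\<lambda>s. \<tau> t s) (at s within {0..1})" if "s \<in> {0..1}" for s
      using assms(7) [OF t that] by (simp add: partial_y_def)
  qed
  have f_eq: "f a b = weighted_double_primitive j \<tau> a b" if "a \<in> {0..1}" "b \<in> {0..1}" for a b
    using assms(8) [OF that] by (simp add: weighted_double_primitive_def mult.assoc)
  have f_eq': "f a b = weighted_double_primitive j ?\<tau>' b a" if "a \<in> {0..1}" "b \<in> {0..1}" for a b
    using f_eq [OF that] weighted_double_primitive_swap [OF cont that] by simp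
  have node_n: "akr_node j n i \<in> {0..1}" if "i \<in> {0..n}" for i
    using akr_node_mem [OF j assms(2)] that by simp
  have node_m: "akr_node j m k \<in> {0..1}" if "k \<in> {0..m}" for k
    using akr_node_mem [OF j assms(3)] that by simp

  show "f x y \<le> akr2 n m j f x y"
  proof -
    have "f x y \<le> (\<Sum>i=0..n. f (akr_node j n i) y * Bernstein n i x)"
      using weighted_double_primitive_le_akr [OF cont mono_x j assms(2) x y]
      by (simp add: f_eq x y node_n cong: sum.cong del: atLeastAtMost_iff)
    also have "\<dots> \<le> (\<Sum>i=0..n.
        (\<Sum>k=0..m. f (akr_node j n i) (akr_node j m k) * Bernstein m k y) * Bernstein n i x)"
    proof (intro sum_mono mult_right_mono)
      fix i assume i: "i \<in> {0..n}"
      show "f (akr_node j n i) y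
          \<le> (\<Sum>k=0..m. f (akr_node j n i) (akr_node j m k) * Bernstein m k y)"
        using weighted_double_primitive_le_akr [OF cont' mono_y j assms(3) y node_n [OF i]]
        by (simp add: f_eq' y node_n [OF i] node_m cong: sum.cong del: atLeastAtMost_iff)
      show "0 \<le> Bernstein n i x"
        using x by (simp add: Bernstein_nonneg)
    qed
    also have "\<dots> = akr2 n m j f x y"
      by (simp add: akr2_def sum_distrib_left mult_ac)
    finally show ?thesis .
  qed

  show "akr2 n m j f x y \<le> bernstein2 n m f x y"
    unfolding akr2_def bernstein2_def
  proof (intro sum_mono mult_right_mono)
    fix i k assume i: "i \<in> {0..n}" and k: "k \<in> {0..m}"
    have grid: "real i / real n \<in> {0..1}" "real k / real m \<in> {0..1}"
      using i k by (auto simp: divide_le_eq)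
    have "f (akr_node j n i) (akr_node j m k) \<le> f (real i / real n) (akr_node j m k)"
      using weighted_double_primitive_mono [OF cont assms(5) _ akr_node_le [OF j assms(2)] _ node_m [OF k]]
        node_n [OF i] node_m [OF k] grid i
      by (simp add: f_eq)
    also have "\<dots> \<le> f (real i / real n) (real k / real m)"
      using weighted_double_primitive_mono [OF cont' assms(5) _ akr_node_le [OF j assms(3)] _ grid(1)]
        node_m [OF k] grid k
      by (simp add: f_eq')
    finally show "f (akr_node j n i) (akr_node j m k) \<le> f (real i / real n) (real k / real m)" .
    show "0 \<le> Bernstein n i x" "0 \<le> Bernstein m k y"
      using x y by (simp_all add: Bernstein_nonneg)
  qed
qed

end
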